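(* Consider the single-level estimator $\mathcal{A}(M,P,N)$ with $M$ samples, $P$ particles and $N$ time steps described in the context, and assume the rates (i)–(iii) and the work model (iv) of the context, so that the total error of $\mathcal{A}(M,P,N)$ is bounded, up to a multiplicative constant, by $$M^{-\frac12}P^{-1}+N^{-1}+P^{-2}.$$ If $M$, $P$ and $N$ are chosen optimally, i.e. so as to minimize the work among all choices for which this error bound is at most a given tolerance $\mathrm{TOL}>0$, then the resulting minimal computational work satisfies $$\mathrm{Work}(M,P,N)=\mathcal{O}(\mathrm{TOL}^{-3})\quad\text{as }\mathrm{TOL}\to0 .$$
   Context: Setting: $Z$ solves a McKean–Vlasov SDE on $[0,T]$ and $\mathbb{E}[g(Z(T))]$ is to be approximated, with $g:\mathbb{R}\to\mathbb{R}$ smooth with bounded derivatives. For a $P$-particle system driven by coupled randomly shifted quasi-Monte Carlo input, $\boldsymbol{X}_N^P\in\mathbb{R}^P$ denotes the vector of particles at time $T$ of its Euler–Maruyama approximation with $N$ steps, $\boldsymbol{X}^P(T)$ the continuous-time limit $N\to\infty$, and $G^P(x)=\frac1P\sum_{j=1}^Pg(x_j)$. The estimator $\mathcal{A}(M,P,N)$ is the average of $M$ independent realizations (independent random shifts) of $G^P(\boldsymbol{X}_N^P)$. Hypotheses (with constants independent of $M,P,N$): (i) $|\mathbb{E}[G^P(\boldsymbol{X}_N^P)-G^P(\boldsymbol{X}^P(T))]|\lesssim N^{-1}$; (ii) $|\mathbb{E}[G^P(\boldsymbol{X}^P(T))-g(Z(T))]|\lesssim P^{-2}$; (iii) $\operatorname{Var}[G^P(\boldsymbol{X}_N^P)]\lesssim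 P^{-2}$, so that the statistical error $|\mathcal{A}(M,P,N)-\mathbb{E}[G^P(\boldsymbol{X}_N^P)]|$ is taken (central limit theorem at a fixed confidence level) to be $\lesssim M^{-1/2}P^{-1}$; (iv) $\mathrm{Work}(M,P,N)=\mathcal{O}(MNP^2)$. *)

theory Defs
  imports "HOL-Probability.Probability" "HOL-Library.Landau_Symbols"
begin

text \<open>Smooth functions all of whose derivatives of order at least one are bounded; the function
  itself may be unbounded.\<close>
definition smooth_bounded_derivs :: "(real \<Rightarrow> real) \<Rightarrow> bool" where
  "smooth_bounded_derivs g \<longleftrightarrow>
     (\<forall>k x. ((deriv ^^ k) g) differentiable (at x)) \<and>
     (\<forall>k\<ge>1. bounded (range ((deriv ^^ k) g)))"

abbreviation particle_space :: "nat \<Rightarrow> (nat \<Rightarrow> real) measure" where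
  "particle_space P \<equiv> PiM {..<P} (\<lambda>_. borel)"

definition particle_mean :: "(real \<Rightarrow> real) \<Rightarrow> nat \<Rightarrow> (nat \<Rightarrow> real) \<Rightarrow> real" where
  "particle_mean g P x = (\<Sum>j<P. g (x j)) / real P"

text \<open>\<open>X P N\<close> maps a random shift to the \<open>P\<close> particles at the final time computed with \<open>N\<close> steps;
  \<open>U P N m\<close> is the \<open>m\<close>-th random shift. The samples used are \<open>m = 0, \<dots>, M - 1\<close>.\<close>
definition estimator ::
  "(real \<Rightarrow> real) \<Rightarrow> (nat \<Rightarrow> nat \<Rightarrow> 's \<Rightarrow> nat \<Rightarrow> real) \<Rightarrow> (nat \<Rightarrow> nat \<Rightarrow> nat \<Rightarrow> 'w \<Rightarrow> 's)
     \<Rightarrow> nat \<Rightarrow> nat \<Rightarrow> nat \<Rightarrow> 'w \<Rightarrow> real" where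
  "estimator g X U M P N \<omega> = (\<Sum>m<M. particle_mean g P (X P N (U P N m \<omega>))) / real M"

definition error_bound :: "nat \<Rightarrow> nat \<Rightarrow> nat \<Rightarrow> real" where
  "error_bound M P N = 1 / (sqrt (real M) * real P) + 1 / real N + 1 / (real P)\<^sup>2"

text \<open>The factor \<open>c\<close> is the multiplicative constant in front of the error bound.\<close>
definition feasible :: "real \<Rightarrow> real \<Rightarrow> (nat \<times> nat \<times> nat) set" where
  "feasible c TOL =
     {(M, P, N). 1 \<le> M \<and> 1 \<le> P \<and> 1 \<le> N \<and> c * error_bound M P N \<le> TOL}"

definition minimal_work :: "(nat \<Rightarrow> nat \<Rightarrow> nat \<Rightarrow> real) \<Rightarrow> real \<Rightarrow> real \<Rightarrow> real" where
  "minimal_work Work c TOL = (INF (M, P, N) \<in> feasible c TOL. Work M P N)"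

definition optimal_choice ::
  "(nat \<Rightarrow> nat \<Rightarrow> nat \<Rightarrow> real) \<Rightarrow> real \<Rightarrow> real \<Rightarrow> nat \<Rightarrow> nat \<Rightarrow> nat \<Rightarrow> bool" where
  "optimal_choice Work c TOL M P N \<longleftrightarrow>
     is_arg_min (\<lambda>(M, P, N). Work M P N) (\<lambda>t. t \<in> feasible c TOL) (M, P, N)"

end

theory Submission imports Defs begin

text \<open>The statistical error is controlled by Chebyshev's inequality: the variance of the average of
  \<open>M\<close> independent samples is at most \<open>C / (M * P\<^sup>2)\<close>, so a deviation of
  \<open>sqrt (C / \<alpha>) / (sqrt M * P)\<close> is exceeded with probability at most \<open>\<alpha>\<close>; the two biases add to it.
  For the work, balance the three error terms: with \<open>t = 3 * c / TOL\<close>, the choice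
  \<open>M, N \<approx> t\<close> and \<open>P \<approx> sqrt t\<close> meets the tolerance and has work of order \<open>t * t * t\<close>.
  Any optimal choice can only be cheaper.\<close>

section \<open>Variances of independent sums and deviation of sample means\<close>

context prob_space
begin

text \<open>Independence makes the mixed term integrable and factorises its expectation, so it
  cancels against the mixed term of the squared mean. Square integrability of the sum is recorded as
  well, since iterating the variance identity needs it.\<close>

lemma
  fixes X Y :: "'a \<Rightarrow> real"
  assumes indep: "indep_var borel X borel Y"
    and [simp]: "integrable M X" "integrable M Y"
      "integrable M (\<lambda>\<omega>. (X \<omega>)\<^sup>2)" "integrable M (\<lambda>\<omega>. (Y \<omega>)\<^sup>2)"
  shows integrable_square_add_indep: "integrable M (\<lambda>\<omega>. (X \<omega> + Y \<omega>)\<^sup>2)"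
    and variance_add_indep: "variance (\<lambda>\<omega>. X \<omega> + Y \<omega>) = variance X + variance Y"
proof -
  have XY [simp]: "integrable M (\<lambda>\<omega>. X \<omega> * Y \<omega>)"
    using indep by (intro indep_var_integrable) auto
  have EXY: "expectation (\<lambda>\<omega>. X \<omega> * Y \<omega>) = expectation X * expectation Y"
    using indep by (intro indep_var_lebesgue_integral) auto
  have expand: "(X \<omega> + Y \<omega>)\<^sup>2 = (X \<omega>)\<^sup>2 + (Y \<omega>)\<^sup>2 + 2 * (X \<omega> * Y \<omega>)" for \<omega>
    by (simp add: power2_sum)
  show sq: "integrable M (\<lambda>\<omega>. (X \<omega> + Y \<omega>)\<^sup>2)"
    unfolding expand by simp
  have E: "expectation (\<lambda>\<omega>. (X \<omega> + Y \<omega>)\<^sup>2) =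
      expectation (\<lambda>\<omega>. (X \<omega>)\<^sup>2) + expectation (\<lambda>\<omega>. (Y \<omega>)\<^sup>2) + 2 * (expectation X * expectation Y)"
    unfolding expand by (simp add: EXY)
  have "variance (\<lambda>\<omega>. X \<omega> + Y \<omega>) =
      expectation (\<lambda>\<omega>. (X \<omega> + Y \<omega>)\<^sup>2) - (expectation X + expectation Y)\<^sup>2"
    using sq by (subst variance_eq) simp_all
  also have "\<dots> = variance X + variance Y"
    unfolding E by (simp add: variance_eq power2_sum)
  finally show "variance (\<lambda>\<omega>. X \<omega> + Y \<omega>) = variance X + variance Y" .
qed

text \<open>Both conclusions go through one induction: the two-variable case is applied to
  \<open>X i\<close> and the remaining sum, whose square integrability is part of the induction
  hypothesis.\<close>

lemma
  fixes X :: "'i \<Rightarrow> 'a \<Rightarrow> real"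
  assumes "finite I" and "indep_vars (\<lambda>_. borel) X I"
    and "\<And>i. i \<in> I \<Longrightarrow> integrable M (X i)"
    and "\<And>i. i \<in> I \<Longrightarrow> integrable M (\<lambda>\<omega>. (X i \<omega>)\<^sup>2)"
  shows integrable_square_sum_indep: "integrable M (\<lambda>\<omega>. (\<Sum>i\<in>I. X i \<omega>)\<^sup>2)"
    and variance_sum_indep: "variance (\<lambda>\<omega>. \<Sum>i\<in>I. X i \<omega>) = (\<Sum>i\<in>I. variance (X i))"
proof -
  have "integrable M (\<lambda>\<omega>. (\<Sum>i\<in>I. X i \<omega>)\<^sup>2) \<and>
    variance (\<lambda>\<omega>. \<Sum>i\<in>I. X i \<omega>) = (\<Sum>i\<in>I. variance (X i))"
    using assms
  proof (induction I rule: finite_induct)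
    case empty
    show ?case by simp
  next
    case (insert i I)
    have indep: "indep_var borel (X i) borel (\<lambda>\<omega>. \<Sum>j\<in>I. X j \<omega>)"
      using insert by (intro indep_vars_sum) auto
    have IH: "integrable M (\<lambda>\<omega>. (\<Sum>j\<in>I. X j \<omega>)\<^sup>2)"
      "variance (\<lambda>\<omega>. \<Sum>j\<in>I. X j \<omega>) = (\<Sum>j\<in>I. variance (X j))"
      using insert indep_vars_subset[OF insert.prems(1), of I] by auto
    have sum: "integrable M (\<lambda>\<omega>. \<Sum>j\<in>I. X j \<omega>)"
      using insert by auto
    show ?case
      using integrable_square_add_indep[OF indep _ sum _ IH(1)]
        variance_add_indep[OF indep _ sum _ IH(1)] insert IH
      by simp
  qed
  then show "integrable M (\<lambda>\<omega>. (\<Sum>i\<in>I. X i \<omega>)\<^sup>2)"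
    and "variance (\<lambda>\<omega>. \<Sum>i\<in>I. X i \<omega>) = (\<Sum>i\<in>I. variance (X i))"
    by auto
qed

text \<open>The sample mean has variance \<open>variance (Y 0) / real n\<close>, so the hypothesis
  \<open>var\<close> is exactly what makes the Chebyshev bound at distance \<open>a\<close> at most
  \<alpha>. Moments are assumed for \<open>Y 0\<close> only and reach the other samples through
  equality of laws.\<close>

lemma sample_mean_deviation:
  fixes Y :: "nat \<Rightarrow> 'a \<Rightarrow> real"
  assumes indep: "indep_vars (\<lambda>_. borel) Y UNIV"
    and distr: "\<And>m. distr M borel (Y m) = distr M borel (Y 0)"
    and int: "integrable M (Y 0)" "integrable M (\<lambda>\<omega>. (Y 0 \<omega>)\<^sup>2)"
    and n: "n \<ge> 1" and \<alpha>: "0 < \<alpha>" and a: "0 < a"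
    and var: "variance (Y 0) \<le> \<alpha> * real n * a\<^sup>2"
  shows "prob {\<omega> \<in> space M. \<bar>(\<Sum>m<n. Y m \<omega>) / real n - expectation (Y 0)\<bar> \<le> a} \<ge> 1 - \<alpha>"
proof -
  have meas [measurable]: "Y m \<in> borel_measurable M" for m
    using indep by (auto simp: indep_vars_def)
  \<comment> \<open>Both sides depend only on the law of the sample. The instances used are the
    identity, the square and the square centred at the mean.\<close>
  have integrable_transfer: "integrable M (\<lambda>\<omega>. f (Y m \<omega>)) \<longleftrightarrow> integrable M (\<lambda>\<omega>. f (Y 0 \<omega>))"
    and expectation_transfer: "expectation (\<lambda>\<omega>. f (Y m \<omega>)) = expectation (\<lambda>\<omega>. f (Y 0 \<omega>))"
    if [measurable]: "f \<in> borel_measurable borel" for f :: "real \<Rightarrow> real" and m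
    using integrable_distr_eq[of "Y m" M borel f] integrable_distr_eq[of "Y 0" M borel f]
      integral_distr[of "Y m" M borel f] integral_distr[of "Y 0" M borel f] distr[of m]
    by simp_all
  define \<mu> where "\<mu> = expectation (Y 0)"
  define v where "v = variance (Y 0)"
  have intm: "integrable M (Y m)" "integrable M (\<lambda>\<omega>. (Y m \<omega>)\<^sup>2)"
    and Em: "expectation (Y m) = \<mu>" for m
    using int integrable_transfer[of "\<lambda>x. x" m] integrable_transfer[of "\<lambda>x. x\<^sup>2" m]
      expectation_transfer[of "\<lambda>x. x" m] by (simp_all add: \<mu>_def)
  have Vm: "variance (Y m) = v" for m
    using expectation_transfer[of "\<lambda>x. (x - \<mu>)\<^sup>2" m] by (simp add: Em v_def)
  define A where "A = (\<lambda>\<omega>. (\<Sum>m<n. Y m \<omega>) / real n)"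
  have [measurable]: "A \<in> borel_measurable M"
    unfolding A_def by measurable
  have sum_sq: "integrable M (\<lambda>\<omega>. (\<Sum>m<n. Y m \<omega>)\<^sup>2)"
    and sum_var: "variance (\<lambda>\<omega>. \<Sum>m<n. Y m \<omega>) = real n * v"
    using integrable_square_sum_indep[OF _ indep_vars_subset[OF indep], of "{..<n}"]
      variance_sum_indep[OF _ indep_vars_subset[OF indep], of "{..<n}"] intm
    by (simp_all add: Vm)
  have A_sq: "integrable M (\<lambda>\<omega>. (A \<omega>)\<^sup>2)"
    using sum_sq by (simp add: A_def power_divide)
  have EA: "expectation A = \<mu>"
    using n intm by (simp add: A_def Em)
  have "variance A = variance (\<lambda>\<omega>. \<Sum>m<n. Y m \<omega>) / (real n)\<^sup>2"
    by (simp add: A_def power_divide flip: diff_divide_distrib)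
  then have VA: "variance A = v / real n"
    unfolding sum_var using n by (simp add: power2_eq_square)
  have "prob {\<omega> \<in> space M. a \<le> \<bar>A \<omega> - expectation A\<bar>} \<le> variance A / a\<^sup>2"
    using A_sq a by (intro Chebyshev_inequality) auto
  also have "\<dots> \<le> \<alpha>"
    using var n a unfolding VA v_def[symmetric] by (simp add: field_simps)
  \<comment> \<open>The event in Chebyshev's inequality is closed, so its complement is the strict
    event \<open>< a\<close>, which lies inside the required event \<open>\<le> a\<close>.\<close>
  finally have "1 - \<alpha> \<le> 1 - prob {\<omega> \<in> space M. a \<le> \<bar>A \<omega> - expectation A\<bar>}"
    by simp
  also have "\<dots> = prob (space M - {\<omega> \<in> space M. a \<le> \<bar>A \<omega> - expectation A\<bar>})"
    by (intro prob_compl[symmetric]) measurable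
  also have "\<dots> \<le> prob {\<omega> \<in> space M. \<bar>A \<omega> - expectation A\<bar> \<le> a}"
    by (intro finite_measure_mono) auto
  finally show ?thesis
    unfolding EA unfolding \<mu>_def A_def .
qed

end

section \<open>Measurability of the particle mean and the three-term error bound\<close>

lemma particle_mean_measurable [measurable]:
  assumes "smooth_bounded_derivs g"
  shows "particle_mean g P \<in> borel_measurable (particle_space P)"
proof -
  \<comment> \<open>This is the case \<open>k = 0\<close> of the smoothness condition; it yields
    continuity and hence Borel measurability of \<open>g\<close>.\<close>
  have "g differentiable (at x)" for x
    using assms unfolding smooth_bounded_derivs_def by (metis funpow_0)
  then have "continuous_on UNIV g"
    by (simp add: continuous_at_imp_continuous_on differentiable_imp_continuous_within)
  then have [measurable]: "g \<in> borel_measurable borel"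
    by (rule borel_measurable_continuous_onI)
  show ?thesis
    unfolding particle_mean_def by measurable
qed

text \<open>Merges the separate constants of the statistical error, the time bias and the particle
  bias into a single factor.\<close>

lemma error_bound_ge:
  assumes "0 \<le> K1" "0 \<le> K2" "0 \<le> K3" "K1 \<le> C" "K2 \<le> C" "K3 \<le> C"
  shows "K1 / (sqrt (real M) * real P) + K2 / real N + K3 / (real P)\<^sup>2 \<le> C * error_bound M P N"
proof -
  have "K1 / (sqrt (real M) * real P) + K2 / real N + K3 / (real P)\<^sup>2
      \<le> C / (sqrt (real M) * real P) + C / real N + C / (real P)\<^sup>2"
    using assms by (intro add_mono divide_right_mono) auto
  then show ?thesis
    by (simp add: error_bound_def distrib_left)
qed

section \<open>A balanced choice of samples, particles and steps\<close>

lemma exists_balanced_choice: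
  fixes t :: real
  assumes "t > 0"
  obtains M P N :: nat where "M \<ge> 1" "P \<ge> 1" "N \<ge> 1" "error_bound M P N \<le> 3 / t"
    "real M * real N * (real P)\<^sup>2 \<le> (t + 1)\<^sup>2 * (sqrt t + 1)\<^sup>2"
proof -
  \<comment> \<open>\<open>n\<close> serves as both the number of samples and the number of steps.
    Rounding up keeps \<open>sqrt n * p\<close>, \<open>n\<close> and the square of \<open>p\<close>
    at least \<open>t\<close>, so each error term is at most \<open>1 / t\<close>; it costs at most
    one per factor, hence \<open>t + 1\<close> and \<open>sqrt t + 1\<close>.\<close>
  define n where "n = nat \<lceil>t\<rceil>"
  define p where "p = nat \<lceil>sqrt t\<rceil>"
  have st: "0 < sqrt t"
    using assms by simp
  have n: "t \<le> real n" "real n \<le> t + 1" and p: "sqrt t \<le> real p" "real p \<le> sqrt t + 1"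
    unfolding n_def p_def using assms st by linarith+
  have pos: "0 < real n" "0 < real p"
    using n p assms st by linarith+
  have sqrt_sqrt: "sqrt t * sqrt t = t"
    using assms by simp
  have "t \<le> sqrt (real n) * real p"
    using mult_mono[of "sqrt t" "sqrt (real n)" "sqrt t" "real p"] n p assms sqrt_sqrt by simp
  then have 1: "1 / (sqrt (real n) * real p) \<le> 1 / t"
    using assms pos by (intro divide_left_mono) auto
  have 2: "1 / real n \<le> 1 / t"
    using assms n pos by (intro divide_left_mono) auto
  have "t \<le> (real p)\<^sup>2"
    using mult_mono[of "sqrt t" "real p" "sqrt t" "real p"] p st sqrt_sqrt
    by (simp add: power2_eq_square)
  then have 3: "1 / (real p)\<^sup>2 \<le> 1 / t"
    using assms pos by (intro divide_left_mono) auto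
  have "real n * real n * (real p)\<^sup>2 \<le> (t + 1) * (t + 1) * (sqrt t + 1)\<^sup>2"
    using n p pos assms st by (intro mult_mono power_mono) auto
  then show ?thesis
    using that[of n p n] 1 2 3 pos by (simp add: error_bound_def power2_eq_square)
qed

text \<open>Feasibility is obtained for every positive tolerance, the work bound only for
  \<open>TOL \<le> 3 * c\<close>. There \<open>t \<ge> 1\<close>, so the rounding losses are
  absorbed by doubling \<open>t\<close> and \<open>sqrt t\<close>, which produces the factor
  16.\<close>

lemma exists_feasible_work_le:
  assumes c: "0 < c" and TOL: "0 < TOL"
  obtains M P N where "(M, P, N) \<in> feasible c TOL"
    "TOL \<le> 3 * c \<Longrightarrow> real M * real N * (real P)\<^sup>2 \<le> 16 * (3 * c) ^ 3 / TOL ^ 3"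
proof -
  \<comment> \<open>Chosen so that the error \<open>3 / t\<close> of the balanced choice, multiplied
    by \<open>c\<close>, equals the tolerance.\<close>
  define t where "t = 3 * c / TOL"
  have t: "0 < t"
    using assms by (simp add: t_def)
  obtain M P N where MPN: "M \<ge> 1" "P \<ge> 1" "N \<ge> 1" "error_bound M P N \<le> 3 / t"
    "real M * real N * (real P)\<^sup>2 \<le> (t + 1)\<^sup>2 * (sqrt t + 1)\<^sup>2"
    using exists_balanced_choice[OF t] .
  have "c * error_bound M P N \<le> c * (3 / t)"
    using MPN c by (intro mult_left_mono) auto
  also have "\<dots> = TOL"
    using assms by (simp add: t_def)
  finally have "(M, P, N) \<in> feasible c TOL"
    using MPN by (simp add: feasible_def)
  moreover have "real M * real N * (real P)\<^sup>2 \<le> 16 * (3 * c) ^ 3 / TOL ^ 3" if "TOL \<le> 3 * c"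
  proof -
    have "1 \<le> t"
      using that TOL by (simp add: t_def)
    then have "(t + 1)\<^sup>2 * (sqrt t + 1)\<^sup>2 \<le> (2 * t)\<^sup>2 * (2 * sqrt t)\<^sup>2"
      by (intro mult_mono power_mono) auto
    also have "\<dots> = 16 * t ^ 3"
      using t by (simp add: power_mult_distrib power3_eq_cube power2_eq_square)
    finally show ?thesis
      using MPN(5) by (simp add: t_def power_divide)
  qed
  ultimately show ?thesis
    using that by blast
qed

section \<open>Consequences of optimality and cubic growth\<close>

lemma feasible_ge_one:
  assumes "(M, P, N) \<in> feasible c TOL"
  shows "M \<ge> 1" "P \<ge> 1" "N \<ge> 1"
  using assms by (auto simp: feasible_def)

text \<open>\<open>is_arg_min\<close> only excludes strictly smaller values; linearity of the order
  on the reals turns this into an inequality. The objective \<open>W\<close> is arbitrary so that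
  both the actual work and the model cost are covered.\<close>

lemma optimal_choice_le:
  assumes "optimal_choice W c TOL M P N" and "(M', P', N') \<in> feasible c TOL"
  shows "W M P N \<le> W M' P' N'"
  using assms by (fastforce simp: optimal_choice_def is_arg_min_def)

text \<open>Near 0 from the right every point lies strictly between 0 and \<open>b\<close>, so a
  bound restricted to \<open>x \<le> b\<close> suffices; nonnegativity of \<open>f\<close> removes
  the norm.\<close>

lemma bigo_cubeI:
  fixes f :: "real \<Rightarrow> real"
  assumes "0 < (b :: real)" and "\<forall>\<^sub>F x in at_right 0. x \<le> b \<longrightarrow> 0 \<le> f x \<and> f x \<le> K / x ^ 3"
  shows "f \<in> O[at_right 0](\<lambda>x. 1 / x ^ 3)"
proof (rule bigoI[where c = K])
  have "\<forall>\<^sub>F x in at_right 0. x \<in> {0<..<b}"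
    using assms(1) by (rule eventually_at_right_real)
  with assms(2) show "\<forall>\<^sub>F x in at_right 0. norm (f x) \<le> K * norm (1 / x ^ 3)"
    by eventually_elim auto
qed

section \<open>Total error and minimal work\<close>

theorem theorem7:
  fixes \<Omega> :: "'w measure"
    and g :: "real \<Rightarrow> real"
    and ZT :: "'w \<Rightarrow> real"
    and XT :: "nat \<Rightarrow> 'w \<Rightarrow> nat \<Rightarrow> real"
    and S :: "nat \<Rightarrow> nat \<Rightarrow> 's measure"
    and U :: "nat \<Rightarrow> nat \<Rightarrow> nat \<Rightarrow> 'w \<Rightarrow> 's"
    and X :: "nat \<Rightarrow> nat \<Rightarrow> 's \<Rightarrow> nat \<Rightarrow> real"
    and Work :: "nat \<Rightarrow> nat \<Rightarrow> nat \<Rightarrow> real"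
  defines "GX \<equiv> \<lambda>P N \<omega>. particle_mean g P (X P N (U P N 0 \<omega>))"
    and "GXT \<equiv> \<lambda>P \<omega>. particle_mean g P (XT P \<omega>)"
  assumes prob: "prob_space \<Omega>"
    and g: "smooth_bounded_derivs g"
    and ZT: "ZT \<in> borel_measurable \<Omega>" "integrable \<Omega> (\<lambda>\<omega>. g (ZT \<omega>))"
    and XT: "\<And>P. P \<ge> 1 \<Longrightarrow> XT P \<in> measurable \<Omega> (particle_space P)"
            "\<And>P. P \<ge> 1 \<Longrightarrow> integrable \<Omega> (GXT P)"
    and X: "\<And>P N. P \<ge> 1 \<Longrightarrow> N \<ge> 1 \<Longrightarrow> X P N \<in> measurable (S P N) (particle_space P)"
           "\<And>P N. P \<ge> 1 \<Longrightarrow> N \<ge> 1 \<Longrightarrow> integrable \<Omega> (GX P N)"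
           "\<And>P N. P \<ge> 1 \<Longrightarrow> N \<ge> 1 \<Longrightarrow> integrable \<Omega> (\<lambda>\<omega>. (GX P N \<omega>)\<^sup>2)"
    and shifts_indep:
      "\<And>P N. P \<ge> 1 \<Longrightarrow> N \<ge> 1 \<Longrightarrow> prob_space.indep_vars \<Omega> (\<lambda>_. S P N) (U P N) UNIV"
    and shifts_distr:
      "\<And>P N m. P \<ge> 1 \<Longrightarrow> N \<ge> 1 \<Longrightarrow> distr \<Omega> (S P N) (U P N m) = distr \<Omega> (S P N) (U P N 0)"
    and time_bias:
      "\<exists>C. \<forall>P\<ge>1. \<forall>N\<ge>1.
         \<bar>prob_space.expectation \<Omega> (\<lambda>\<omega>. GX P N \<omega> - GXT P \<omega>)\<bar> \<le> C / real N"
    and particle_bias: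
      "\<exists>C. \<forall>P\<ge>1.
         \<bar>prob_space.expectation \<Omega> (\<lambda>\<omega>. GXT P \<omega> - g (ZT \<omega>))\<bar> \<le> C / (real P)\<^sup>2"
    and var:
      "\<exists>C. \<forall>P\<ge>1. \<forall>N\<ge>1. prob_space.variance \<Omega> (GX P N) \<le> C / (real P)\<^sup>2"
    and work_nonneg: "\<And>M P N. M \<ge> 1 \<Longrightarrow> P \<ge> 1 \<Longrightarrow> N \<ge> 1 \<Longrightarrow> 0 \<le> Work M P N"
    and work:
      "\<exists>C. \<forall>M\<ge>1. \<forall>P\<ge>1. \<forall>N\<ge>1. Work M P N \<le> C * (real M * real N * (real P)\<^sup>2)"
  shows
    "(\<forall>\<alpha>. 0 < \<alpha> \<and> \<alpha> < 1 \<longrightarrow>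
        (\<exists>C>0. \<forall>M\<ge>1. \<forall>P\<ge>1. \<forall>N\<ge>1.
           prob_space.prob \<Omega> {\<omega> \<in> space \<Omega>.
             \<bar>estimator g X U M P N \<omega> - prob_space.expectation \<Omega> (\<lambda>\<omega>. g (ZT \<omega>))\<bar>
               \<le> C * error_bound M P N} \<ge> 1 - \<alpha>))
     \<and> (\<forall>c>0.
          (\<forall>TOL>0. feasible c TOL \<noteq> {})
        \<and> minimal_work Work c \<in> O[at_right 0](\<lambda>TOL. 1 / TOL ^ 3)
        \<and> (\<forall>W \<in> {Work, \<lambda>M P N. real M * real N * (real P)\<^sup>2}. \<forall>M P N :: real \<Rightarrow> nat.
             (\<forall>\<^sub>F TOL in at_right 0. optimal_choice W c TOL (M TOL) (P TOL) (N TOL)) \<longrightarrow>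
             (\<lambda>TOL. Work (M TOL) (P TOL) (N TOL)) \<in> O[at_right 0](\<lambda>TOL. 1 / TOL ^ 3)))"
proof (intro conjI allI impI)
  interpret prob_space \<Omega> by (rule prob)
  fix \<alpha> :: real
  assume \<alpha>: "0 < \<alpha> \<and> \<alpha> < 1"
  obtain C1 where C1: "\<bar>expectation (\<lambda>\<omega>. GX P N \<omega> - GXT P \<omega>)\<bar> \<le> C1 / real N"
    if "P \<ge> 1" "N \<ge> 1" for P N
    using time_bias by blast
  obtain C2 where C2: "\<bar>expectation (\<lambda>\<omega>. GXT P \<omega> - g (ZT \<omega>))\<bar> \<le> C2 / (real P)\<^sup>2"
    if "P \<ge> 1" for P
    using particle_bias by blast
  obtain C3 where C3: "variance (GX P N) \<le> C3 / (real P)\<^sup>2" if "P \<ge> 1" "N \<ge> 1" for P N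
    using var by blast
  \<comment> \<open>With \<alpha> times the square of \<open>K\<close> equal to
    \<open>max C3 1\<close>, Chebyshev at distance \<open>K / (sqrt M * P)\<close> yields confidence
    level \<open>1 - \<alpha>\<close>. The maximum with 1 keeps \<open>K\<close> positive even if
    \<open>C3\<close> is zero.\<close>
  define K where "K = sqrt (max C3 1 / \<alpha>)"
  define C where "C = K + \<bar>C1\<bar> + \<bar>C2\<bar>"
  have K: "0 < K" "\<alpha> * K\<^sup>2 = max C3 1"
    using \<alpha> by (simp_all add: K_def)
  show "\<exists>C>0. \<forall>M\<ge>1. \<forall>P\<ge>1. \<forall>N\<ge>1. prob {\<omega> \<in> space \<Omega>.
      \<bar>estimator g X U M P N \<omega> - expectation (\<lambda>\<omega>. g (ZT \<omega>))\<bar> \<le> C * error_bound M P N} \<ge> 1 - \<alpha>"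
  proof (intro exI[of _ C] conjI allI impI)
    show "0 < C"
      using K by (simp add: C_def)
    fix M P N :: nat
    assume M: "1 \<le> M" and P: "1 \<le> P" and N: "1 \<le> N"
    define Y where "Y = (\<lambda>m \<omega>. particle_mean g P (X P N (U P N m \<omega>)))"
    have GX: "GX P N = Y 0"
      by (simp add: GX_def Y_def)
    define a where "a = K / (sqrt (real M) * real P)"
    have U [measurable]: "U P N m \<in> measurable \<Omega> (S P N)" for m
      using shifts_indep[OF P N] by (auto simp: indep_vars_def)
    have F [measurable]: "(\<lambda>s. particle_mean g P (X P N s)) \<in> borel_measurable (S P N)"
      using particle_mean_measurable[OF g] X(1)[OF P N] by measurable
    have indep: "indep_vars (\<lambda>_. borel) Y UNIV"
      unfolding Y_def by (rule indep_vars_compose2[OF shifts_indep[OF P N]]) (rule F)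
    \<comment> \<open>All samples are images of the shifts under the same map, so equality of the
      laws of the shifts passes to the \<open>Y m\<close>.\<close>
    have push: "distr \<Omega> borel (Y m) = distr (distr \<Omega> (S P N) (U P N m)) borel
        (\<lambda>s. particle_mean g P (X P N s))" for m
      by (simp add: distr_distr Y_def comp_def)
    have distr: "distr \<Omega> borel (Y m) = distr \<Omega> borel (Y 0)" for m
      by (simp only: push shifts_distr[OF P N, of m])
    have "variance (Y 0) \<le> max C3 1 / (real P)\<^sup>2"
      using C3[OF P N] P by (simp add: GX) (smt (verit) divide_right_mono zero_le_power2)
    also have "\<dots> = \<alpha> * real M * a\<^sup>2"
      using M by (simp add: a_def power_divide power_mult_distrib flip: K(2))
    finally have var0: "variance (Y 0) \<le> \<alpha> * real M * a\<^sup>2" .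
    have a: "0 < a"
      using K M P by (simp add: a_def)
    have dev: "1 - \<alpha> \<le> prob {\<omega> \<in> space \<Omega>. \<bar>estimator g X U M P N \<omega> - expectation (Y 0)\<bar> \<le> a}"
      using sample_mean_deviation[OF indep distr _ _ M _ a var0] X(2,3)[OF P N] \<alpha>
      by (simp add: GX estimator_def Y_def)
    \<comment> \<open>The total bias is split at the continuous-time particle system
      \<open>GXT P\<close>.\<close>
    have "expectation (Y 0) - expectation (\<lambda>\<omega>. g (ZT \<omega>)) =
        expectation (\<lambda>\<omega>. GX P N \<omega> - GXT P \<omega>) + expectation (\<lambda>\<omega>. GXT P \<omega> - g (ZT \<omega>))"
      using X(2)[OF P N] XT(2)[OF P] ZT(2) by (simp add: GX)
    moreover have "C1 / real N \<le> \<bar>C1\<bar> / real N" "C2 / (real P)\<^sup>2 \<le> \<bar>C2\<bar> / (real P)\<^sup>2"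
      by (intro divide_right_mono; simp)+
    ultimately have bias: "\<bar>expectation (Y 0) - expectation (\<lambda>\<omega>. g (ZT \<omega>))\<bar>
        \<le> \<bar>C1\<bar> / real N + \<bar>C2\<bar> / (real P)\<^sup>2"
      using C1[OF P N] C2[OF P] by linarith
    have total: "a + (\<bar>C1\<bar> / real N + \<bar>C2\<bar> / (real P)\<^sup>2) \<le> C * error_bound M P N"
      using error_bound_ge[of K "\<bar>C1\<bar>" "\<bar>C2\<bar>" C M P N] K by (simp add: a_def C_def)
    have [measurable]: "estimator g X U M P N \<in> borel_measurable \<Omega>"
      unfolding estimator_def by measurable
    \<comment> \<open>By the triangle inequality, a statistical deviation of at most
      \<open>a\<close> together with the deterministic bias forces the total error below the
      bound.\<close>
    have "prob {\<omega> \<in> space \<Omega>. \<bar>estimator g X U M P N \<omega> - expectation (Y 0)\<bar> \<le> a} \<le>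
        prob {\<omega> \<in> space \<Omega>. \<bar>estimator g X U M P N \<omega> - expectation (\<lambda>\<omega>. g (ZT \<omega>))\<bar>
          \<le> C * error_bound M P N}"
    proof (rule finite_measure_mono)
      show "{\<omega> \<in> space \<Omega>. \<bar>estimator g X U M P N \<omega> - expectation (Y 0)\<bar> \<le> a} \<subseteq>
          {\<omega> \<in> space \<Omega>. \<bar>estimator g X U M P N \<omega> - expectation (\<lambda>\<omega>. g (ZT \<omega>))\<bar>
            \<le> C * error_bound M P N}"
        using bias total by (intro Collect_mono) linarith
    qed measurable
    with dev show "1 - \<alpha> \<le> prob {\<omega> \<in> space \<Omega>.
        \<bar>estimator g X U M P N \<omega> - expectation (\<lambda>\<omega>. g (ZT \<omega>))\<bar> \<le> C * error_bound M P N}"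
      by linarith
  qed
next
  fix c TOL :: real
  assume "0 < c" "0 < TOL"
  then show "feasible c TOL \<noteq> {}"
    using exists_feasible_work_le by blast
next
  fix c :: real
  assume c: "0 < c"
  obtain C where C: "Work M P N \<le> C * (real M * real N * (real P)\<^sup>2)"
    if "M \<ge> 1" "P \<ge> 1" "N \<ge> 1" for M P N
    using work by blast
  let ?K = "16 * (3 * c) ^ 3"
  \<comment> \<open>Evaluating the work model at one sample, one particle and one step gives
    \<open>0 \<le> Work 1 1 1 \<le> C\<close>; the sign allows scaling bounds on the model cost by
    \<open>C\<close>.\<close>
  have C_nonneg: "0 \<le> C"
    using C[of 1 1 1] work_nonneg[of 1 1 1] by simp
  have witness: "\<exists>M P N. (M, P, N) \<in> feasible c TOL \<and> real M * real N * (real P)\<^sup>2 \<le> ?K / TOL ^ 3"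
    if "0 < TOL" "TOL \<le> 3 * c" for TOL
    using exists_feasible_work_le[OF c that(1)] that(2) by metis
  have C_scale: "C * w \<le> C * ?K / TOL ^ 3" if "w \<le> ?K / TOL ^ 3" for w TOL :: real
    using mult_left_mono[OF that C_nonneg] by simp
  \<comment> \<open>A real infimum obeys these bounds only over a nonempty set with a lower bound:
    the given triple provides the former, nonnegativity of the work the latter.\<close>
  have min_le: "minimal_work Work c TOL \<le> Work M P N" and min_ge: "0 \<le> minimal_work Work c TOL"
    if "(M, P, N) \<in> feasible c TOL" for M P N TOL
  proof -
    have nonneg: "0 \<le> (case t of (M, P, N) \<Rightarrow> Work M P N)" if "t \<in> feasible c TOL" for t
      using that by (cases t) (auto simp: feasible_def intro: work_nonneg)
    then have "bdd_below ((\<lambda>(M, P, N). Work M P N) ` feasible c TOL)"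
      by (intro bdd_belowI2)
    then show "minimal_work Work c TOL \<le> Work M P N"
      unfolding minimal_work_def using cINF_lower[OF _ that] by fastforce
    show "0 \<le> minimal_work Work c TOL"
      unfolding minimal_work_def using that nonneg by (intro cINF_greatest) auto
  qed
  show "minimal_work Work c \<in> O[at_right 0](\<lambda>TOL. 1 / TOL ^ 3)"
  proof (rule bigo_cubeI[where b = "3 * c" and K = "C * ?K"])
    show "\<forall>\<^sub>F TOL in at_right 0. TOL \<le> 3 * c \<longrightarrow>
        0 \<le> minimal_work Work c TOL \<and> minimal_work Work c TOL \<le> C * ?K / TOL ^ 3"
      using eventually_at_right_less[of "0 :: real"]
    proof eventually_elim
      case (elim TOL)
      show ?case
      proof
        assume "TOL \<le> 3 * c"
        then obtain M P N where MPN: "(M, P, N) \<in> feasible c TOL"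
          "real M * real N * (real P)\<^sup>2 \<le> ?K / TOL ^ 3"
          using witness elim by blast
        show "0 \<le> minimal_work Work c TOL \<and> minimal_work Work c TOL \<le> C * ?K / TOL ^ 3"
          using min_ge[OF MPN(1)] min_le[OF MPN(1)] C[OF feasible_ge_one[OF MPN(1)]]
            C_scale[OF MPN(2)] by linarith
      qed
    qed
  qed (use c in simp)
  show "\<forall>W \<in> {Work, \<lambda>M P N. real M * real N * (real P)\<^sup>2}. \<forall>M P N :: real \<Rightarrow> nat.
      (\<forall>\<^sub>F TOL in at_right 0. optimal_choice W c TOL (M TOL) (P TOL) (N TOL)) \<longrightarrow>
      (\<lambda>TOL. Work (M TOL) (P TOL) (N TOL)) \<in> O[at_right 0](\<lambda>TOL. 1 / TOL ^ 3)"
  proof (intro ballI allI impI)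
    fix W and M P N :: "real \<Rightarrow> nat"
    assume W: "W \<in> {Work, \<lambda>M P N. real M * real N * (real P)\<^sup>2}"
      and opt: "\<forall>\<^sub>F TOL in at_right 0. optimal_choice W c TOL (M TOL) (P TOL) (N TOL)"
    show "(\<lambda>TOL. Work (M TOL) (P TOL) (N TOL)) \<in> O[at_right 0](\<lambda>TOL. 1 / TOL ^ 3)"
    proof (rule bigo_cubeI[where b = "3 * c" and K = "C * ?K"])
      show "\<forall>\<^sub>F TOL in at_right 0. TOL \<le> 3 * c \<longrightarrow>
          0 \<le> Work (M TOL) (P TOL) (N TOL) \<and> Work (M TOL) (P TOL) (N TOL) \<le> C * ?K / TOL ^ 3"
        using eventually_at_right_less[of "0 :: real"] opt
      proof eventually_elim
        case (elim TOL)
        show ?case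
        proof
          assume "TOL \<le> 3 * c"
          then obtain M' P' N' where w: "(M', P', N') \<in> feasible c TOL"
            "real M' * real N' * (real P')\<^sup>2 \<le> ?K / TOL ^ 3"
            using witness elim by blast
          have feas: "(M TOL, P TOL, N TOL) \<in> feasible c TOL"
            using elim(2) by (simp add: optimal_choice_def is_arg_min_def)
          note ge_one = feasible_ge_one[OF feas]
          have "Work (M TOL) (P TOL) (N TOL) \<le> C * ?K / TOL ^ 3"
          \<comment> \<open>If the actual work is minimized, the model bound is applied at the
            balanced witness. If the model cost is minimized, the optimum inherits the witness's
            bound on that cost, and the model bound is applied at the optimum itself.\<close>
          proof (cases "W = Work")
            case True
            then show ?thesis
              using optimal_choice_le[OF elim(2) w(1)] C[OF feasible_ge_one[OF w(1)]]
                C_scale[OF w(2)] by simp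
          next
            case False
            with W have "real (M TOL) * real (N TOL) * (real (P TOL))\<^sup>2 \<le> ?K / TOL ^ 3"
              using optimal_choice_le[OF elim(2) w(1)] w(2) by simp
            then show ?thesis
              using C[OF ge_one] C_scale by (meson order_trans)
          qed
          with work_nonneg[OF ge_one]
          show "0 \<le> Work (M TOL) (P TOL) (N TOL) \<and>
              Work (M TOL) (P TOL) (N TOL) \<le> C * ?K / TOL ^ 3"
            by blast
        qed
      qed
    qed (use c in simp)
  qed
qed

end
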